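(* Let $\boldsymbol{k}=(k_1,\dots,k_r;\sigma_1,\dots,\sigma_r)$ with $k_j\in\mathbb{N}$, $\sigma_j\in\{\pm1\}$ and $(k_r,\sigma_r)\neq(1,1)$. Define its dual $$\boldsymbol{k}^*:=\mathbf{q}\big(\omega_1^{k_r-1}u_{\sigma_r}\,\omega_1^{k_{r-1}-1}u_{\sigma_{r-1}\sigma_r}\cdots\omega_1^{k_2-1}u_{\sigma_2\sigma_3\cdots\sigma_r}\,\omega_1^{k_1-1}u_{\sigma_1\sigma_2\cdots\sigma_r}\big),$$ where $u_{-1}:=\omega_{-1}$, $u_1:=\omega_0$. Then $$T(\boldsymbol{k})=T(\boldsymbol{k}^* ).$$
   Context: For positive integers $k_1,\dots,k_r$ and signs $\sigma_1,\dots,\sigma_r\in\{\pm1\}$ with $(k_r,\sigma_r)\ne(1,1)$, define $$T(k_1,\dots,k_r;\sigma_1,\dots,\sigma_r):=2^r\sum_{0<n_1<\cdots<n_r}\frac{\sigma_1^{n_1}\sigma_2^{n_2}\cdots\sigma_r^{n_r}}{(2n_1-1)^{k_1}(2n_2-2)^{k_2}\cdots(2n_r-r)^{k_r}}$$ (conditionally convergent sums are limits as $N\to\infty$ of the sums over $n_r\le N$). Consider words in three letters $\omega_{-1},\omega_0,\omega_1$ (corresponding to the 1-forms $\omega_{-1}=\frac{2\,dt}{1+t^2}$, $\omega_0=\frac{dt}{t}$, $\omega_1=\frac{2\,dt}{1-t^2}$). Every word not beginning with $\omega_0$ can be written uniquely as $\omega_{\tau_1}\omega_0^{c_1-1}\omega_{\tau_2}\omega_0^{c_2-1}\cdots\omega_{\tau_s}\omega_0^{c_s-1}$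 with $\tau_j\in\{\pm1\}$, $c_j\in\mathbb{N}$, and one sets $$\mathbf{q}\big(\omega_{\tau_1}\omega_0^{c_1-1}\cdots\omega_{\tau_s}\omega_0^{c_s-1}\big):=(c_1,\dots,c_s;\ \tau_1/\tau_2,\ \tau_2/\tau_3,\dots,\tau_{s-1}/\tau_s,\ \tau_s).$$ *)

theory Defs
  imports Complex_Main
begin

(* An index (k_1,...,k_r; sigma_1,...,sigma_r) is the list [(k_1,sigma_1),...,(k_r,sigma_r)]. *)
type_synonym index = "(nat \<times> int) list"

definition is_index :: "index \<Rightarrow> bool" where
  "is_index k \<longleftrightarrow> (\<forall>(c, s) \<in> set k. 1 \<le> c \<and> s \<in> {1, - 1})"

(* Positions in a list count from 0, so the denominator 2 n_j - j is 2 * (ns ! j) - (j + 1).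
   The subtraction is in the reals; it is positive because ns is strictly increasing
   with positive entries. *)
definition T_partial :: "index \<Rightarrow> nat \<Rightarrow> real" where
  "T_partial k N =
     2 ^ length k *
     (\<Sum>ns \<in> {ns. length ns = length k \<and> sorted_wrt (<) ns \<and> set ns \<subseteq> {1..N}}.
        \<Prod>j<length k.
          of_int (snd (k ! j)) ^ (ns ! j) / (2 * real (ns ! j) - real (j + 1)) ^ fst (k ! j))"

(* The limit of partial sums covers the conditionally convergent case too. *)
definition T_value :: "index \<Rightarrow> real" where
  "T_value k = lim (\<lambda>N. T_partial k N)"

(* Formal letters for the 1-forms 2 dt/(1+t^2), dt/t and 2 dt/(1-t^2), in this order. *)
datatype letter = Omega_m1 | Omega_0 | Omega_1

definition omega :: "int \<Rightarrow> letter" where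
  "omega t = (if t = - 1 then Omega_m1 else if t = 0 then Omega_0 else Omega_1)"

definition word_of_blocks :: "(nat \<times> int) list \<Rightarrow> letter list" where
  "word_of_blocks bs = concat (map (\<lambda>(c, t). omega t # replicate (c - 1) Omega_0) bs)"

(* Meaningful for the words not beginning with Omega_0; see ex1_blocks. *)
definition blocks :: "letter list \<Rightarrow> (nat \<times> int) list" where
  "blocks w = (THE bs. is_index bs \<and> word_of_blocks bs = w)"

(* The signs are 1 and -1, so the integer division is exact. *)
fun sign_quotients :: "(nat \<times> int) list \<Rightarrow> index" where
  "sign_quotients [] = []"
| "sign_quotients [(c, t)] = [(c, t)]"
| "sign_quotients ((c, t) # (c', t') # bs) = (c, t div t') # sign_quotients ((c', t') # bs)"

definition q_index :: "letter list \<Rightarrow> index" where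
  "q_index w = sign_quotients (blocks w)"

definition u_letter :: "int \<Rightarrow> letter" where
  "u_letter s = (if s = - 1 then Omega_m1 else Omega_0)"

definition dual_word :: "index \<Rightarrow> letter list" where
  "dual_word k =
     concat (map (\<lambda>j. replicate (fst (k ! j) - 1) Omega_1 @
                        [u_letter (\<Prod>i=j..<length k. snd (k ! i))])
       (rev [0..<length k]))"

definition dual_index :: "index \<Rightarrow> index" where
  "dual_index k = q_index (dual_word k)"

lemma word_of_blocks_simps [simp]:
  "word_of_blocks [] = []"
  "word_of_blocks ((c, t) # bs) = omega t # replicate (c - 1) Omega_0 @ word_of_blocks bs"
  by (simp_all add: word_of_blocks_def)

lemma is_index_simps [simp]:
  "is_index []"
  "is_index ((c, t) # bs) \<longleftrightarrow> 1 \<le> c \<and> (t = 1 \<or> t = - 1) \<and> is_index bs"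
  by (auto simp: is_index_def)

lemma word_of_blocks_hd:
  "is_index bs \<Longrightarrow> word_of_blocks bs = [] \<or> hd (word_of_blocks bs) \<noteq> Omega_0"
  by (cases bs) (auto simp: omega_def)

lemma replicate_append_cancel:
  assumes "replicate m z @ v = replicate n z @ w"
    and "v = [] \<or> hd v \<noteq> z" and "w = [] \<or> hd w \<noteq> z"
  shows "m = n \<and> v = w"
  using assms(1)
proof (induction m arbitrary: n)
  case 0
  then show ?case using assms(2) by (cases n) auto
next
  case (Suc m)
  then show ?case using assms(3) by (cases n) auto
qed

lemma word_of_blocks_inj:
  assumes "is_index as" "is_index bs" "word_of_blocks as = word_of_blocks bs"
  shows "as = bs"
  using assms
proof (induction as arbitrary: bs)
  case Nil
  then show ?case by (cases bs) auto
next
  case (Cons a as)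
  obtain c t where a: "a = (c, t)" by (cases a)
  obtain d s bs' where bs: "bs = (d, s) # bs'"
    using Cons.prems(3) a by (cases bs) auto
  have idx: "is_index as" "is_index bs'" "1 \<le> c" "1 \<le> d"
    using Cons.prems a bs by auto
  have "t = s"
    using Cons.prems a bs by (auto simp: omega_def split: if_splits)
  moreover have "replicate (c - 1) Omega_0 @ word_of_blocks as
      = replicate (d - 1) Omega_0 @ word_of_blocks bs'"
    using Cons.prems(3) a bs by simp
  then have "c - 1 = d - 1 \<and> word_of_blocks as = word_of_blocks bs'"
    using replicate_append_cancel word_of_blocks_hd idx(1,2) by metis
  ultimately show ?case
    using Cons.IH[of bs'] idx a bs by auto
qed

lemma ex_blocks:
  "\<exists>n bs. is_index bs \<and> replicate n Omega_0 @ word_of_blocks bs = w"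
proof (induction w)
  case Nil
  have "is_index [] \<and> replicate 0 Omega_0 @ word_of_blocks [] = []" by simp
  then show ?case by blast
next
  case (Cons x w)
  then obtain n bs where nb: "is_index bs" "replicate n Omega_0 @ word_of_blocks bs = w"
    by blast
  show ?case
  proof (cases "x = Omega_0")
    case True
    then have "is_index bs \<and> replicate (Suc n) Omega_0 @ word_of_blocks bs = x # w"
      using nb by simp
    then show ?thesis by blast
  next
    case False
    define t :: int where "t = (if x = Omega_1 then 1 else - 1)"
    have "omega t = x" using False by (cases x) (auto simp: t_def omega_def)
    then have "is_index ((Suc n, t) # bs) \<and>
        replicate 0 Omega_0 @ word_of_blocks ((Suc n, t) # bs) = x # w"
      using nb by (simp add: t_def)
    then show ?thesis by blast
  qed
qed

lemma ex1_blocks: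
  assumes "w = [] \<or> hd w \<noteq> Omega_0"
  shows "\<exists>!bs. is_index bs \<and> word_of_blocks bs = w"
proof -
  obtain n bs where nb: "is_index bs" "replicate n Omega_0 @ word_of_blocks bs = w"
    using ex_blocks by blast
  with assms have "n = 0" by (cases n) auto
  with nb show ?thesis using word_of_blocks_inj by auto
qed

end

theory Submission
  imports Defs "HOL-Analysis.FPS_Convergence"
begin

text \<open>
  The value \<open>T_value k\<close> is, up to sign, an iterated integral over \<open>0 < t\<^sub>1 < t\<^sub>2 < \<dots> < 1\<close> of a word in
  the three 1-forms, and the substitution \<open>t \<mapsto> (1 - t) / (1 + t)\<close> turns the integral of one word into that
  of another. Up to signs, which cancel against the orientation of the path, it exchanges \<open>dt / t\<close> with
  \<open>2 dt / (1 - t\<^sup>2)\<close> and fixes \<open>2 dt / (1 + t\<^sup>2)\<close>; and it reverses the order of integration. On words this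
  is the passage from an index to its dual.

  For the series side, expand each form as a geometric series and integrate from the innermost variable
  outwards. A letter with sign \<open>t\<close> multiplies by \<open>2 / (1 - t x\<^sup>2)\<close>, so the next exponent exceeds the previous
  one by \<open>2 i + 1\<close> with weight \<open>2 t ^ i\<close>; hence the exponents are \<open>m\<^sub>j = 2 n\<^sub>j - j\<close> with \<open>n\<^sub>1 < n\<^sub>2 < \<dots>\<close>, and
  integration supplies the powers of \<open>2 n\<^sub>j - j\<close> in the denominators. The weights multiply to
  \<open>\<Prod>j. t\<^sub>j ^ (n\<^sub>j - n\<^sub>j\<^sub>-\<^sub>1 - 1)\<close>, which is \<open>\<Prod>j. (t\<^sub>j / t\<^sub>j\<^sub>+\<^sub>1) ^ n\<^sub>j\<close> up to the product of all \<open>t\<^sub>j\<close>. So the signs of the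
  index are the quotients of consecutive letter signs, and the global sign is the parity of the number of
  letters \<open>Omega_m1\<close>, which duality preserves. This is \<open>iter_rword_nth\<close>.

  The integrals are handled as power series on \<open>(0, 1)\<close>, which avoids improper integrals. For a splitting of
  a word into an inner part \<open>u\<close> and an outer part \<open>v\<close>, the integral of \<open>u\<close> from \<open>0\<close> to \<open>x\<close> times the integral
  of \<open>v\<close> from \<open>x\<close> to \<open>1\<close> is a product of two such power series, the second one evaluated at
  \<open>(1 - x) / (1 + x)\<close>. Summed over all splittings this expresses the integral from \<open>0\<close> to \<open>1\<close>, so it cannot
  depend on \<open>x\<close>; formally its derivative telescopes to zero (\<open>path_sum_deriv\<close>). Its limits at \<open>1\<close> and at \<open>0\<close>
  are the limits at \<open>1\<close> of the series of the word and of its dual, because an integral grows at most like a power of a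
  logarithm at \<open>1\<close> and vanishes linearly at \<open>0\<close>. This is \<open>iterated_integral_duality\<close>.

  It remains to pass from the limit of the power series at \<open>1\<close> to the sum of its coefficients. The series
  converges (\<open>summable_T_term\<close>), absolutely if \<open>k\<^sub>r \<ge> 2\<close> and by pairing consecutive terms if
  \<open>(k\<^sub>r, \<sigma>\<^sub>r) = (1, - 1)\<close>, and Abel's limit theorem applies.
\<close>

section \<open>Abel's limit theorem\<close>

text \<open>
  Summation by parts turns \<open>\<Sum> a\<^sub>n x\<^sup>n - S\<close> into \<open>(1 - x) \<Sum> (s\<^sub>n - S) x\<^sup>n\<close> with \<open>s\<^sub>n\<close> the partial sums. In the latter,
  finitely many terms are damped by the factor \<open>1 - x\<close>, and the others are bounded by a small multiple of
  \<open>\<Sum> x\<^sup>n = 1 / (1 - x)\<close>.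
\<close>

lemma Abel_limit:
  fixes a :: "nat \<Rightarrow> real"
  assumes "a sums S"
  shows "((\<lambda>x. \<Sum>n. a n * x ^ n) \<longlongrightarrow> S) (at_left 1)"
proof -
  define s where "s n = (\<Sum>i\<le>n. a i)" for n
  have s_lim: "s \<longlonglongrightarrow> S"
    using assms unfolding s_def sums_def_le .
  then have s_bdd: "Bseq s"
    by (rule convergentI[THEN convergent_imp_Bseq])
  then obtain B where B: "B > 0" "\<And>n. \<bar>s n\<bar> \<le> B"
    by (auto elim!: BseqE)
  have s_summable: "summable (\<lambda>n. s n * x ^ n)" if "0 \<le> x" "x < 1" for x
  proof (rule summable_comparison_test')
    show "summable (\<lambda>n. B * x ^ n)"
      using that by (intro summable_mult summable_geometric) auto
    show "norm (s n * x ^ n) \<le> B * x ^ n" for n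
      using B that by (auto simp: abs_mult intro!: mult_right_mono)
  qed
  have by_parts: "(\<Sum>n. a n * x ^ n) - S = (1 - x) * (\<Sum>n. (s n - S) * x ^ n)"
    if x: "0 \<le> x" "x < 1" for x
  proof -
    have geo: "(\<lambda>n. x ^ n) sums (1 / (1 - x))"
      using geometric_sums[of x] x by auto
    have "(\<lambda>n. s n * x ^ n) sums (\<Sum>n. s n * x ^ n)"
      using s_summable x by blast
    from sums_diff[OF this sums_mult[OF geo, of S]]
    have 1: "(\<Sum>n. (s n - S) * x ^ n) = (\<Sum>n. s n * x ^ n) - S / (1 - x)"
      by (simp add: sums_iff algebra_simps)
    \<comment> \<open>The partial sums satisfy \<open>s (Suc n) = s n + a (Suc n)\<close>, so shifting the index of \<open>?y\<close> and subtracting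
        \<open>x * ?y\<close> leaves the original series.\<close>
    let ?y = "\<Sum>n. s n * x ^ n"
    have "(\<lambda>n. s n * x ^ n) sums ?y"
      using s_summable x by blast
    then have "(\<lambda>n. s (Suc n) * x ^ Suc n) sums (?y - s 0)"
      using sums_Suc_iff[of "\<lambda>n. s n * x ^ n"] by auto
    from sums_diff[OF this sums_mult[OF \<open>(\<lambda>n. s n * x ^ n) sums ?y\<close>, of x]]
    have "(\<lambda>n. a (Suc n) * x ^ Suc n) sums (?y - s 0 - x * ?y)"
      by (simp add: s_def algebra_simps)
    then have "(\<lambda>n. a n * x ^ n) sums (?y - x * ?y)"
      using sums_Suc_iff[of "\<lambda>n. a n * x ^ n" "?y - s 0 - x * ?y"] by (simp add: s_def)
    then have "(\<Sum>n. a n * x ^ n) = (1 - x) * ?y"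
      by (simp add: sums_iff algebra_simps)
    moreover have "(1 - x) * (?y - S / (1 - x)) = (1 - x) * ?y - S"
      using x by (simp add: right_diff_distrib)
    ultimately show ?thesis
      unfolding 1 by simp
  qed
  show ?thesis
  proof (rule tendstoI)
    fix e :: real assume e: "e > 0"
    obtain N where N: "\<And>n. n \<ge> N \<Longrightarrow> \<bar>s n - S\<bar> < e / 2"
      using LIMSEQ_D[OF s_lim, of "e/2"] e by auto
    define C where "C = (\<Sum>n<N. \<bar>s n - S\<bar>)"
    have C: "C \<ge> 0" by (simp add: C_def sum_nonneg)
    have "((\<lambda>x. (1 - x) * C) \<longlongrightarrow> (1 - 1) * C) (at_left (1::real))"
      by (intro tendsto_intros)
    then have "\<forall>\<^sub>F x in at_left (1::real). (1 - x) * C < e / 2"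
      using e by (intro order_tendstoD(2)) auto
    moreover have "\<forall>\<^sub>F x in at_left (1::real). x \<in> {0<..<1}"
      by (rule eventually_at_left_real) simp
    ultimately show "\<forall>\<^sub>F x in at_left 1. dist (\<Sum>n. a n * x ^ n) S < e"
    proof eventually_elim
      case (elim x)
      then have x: "0 \<le> x" "x < 1" by auto
      have geo: "(\<lambda>n. x ^ n) sums (1 / (1 - x))"
        using geometric_sums[of x] x by auto
      have sm: "summable (\<lambda>n. \<bar>(s n - S) * x ^ n\<bar>)"
      proof (rule summable_comparison_test')
        show "summable (\<lambda>n. (B + \<bar>S\<bar>) * x ^ n)"
          using x by (intro summable_mult summable_geometric) auto
        show "norm \<bar>(s n - S) * x ^ n\<bar> \<le> (B + \<bar>S\<bar>) * x ^ n" for n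
          using B(2)[of n] x by (auto simp: abs_mult intro!: mult_right_mono)
      qed
      have "\<bar>\<Sum>n. (s n - S) * x ^ n\<bar> \<le> (\<Sum>n. \<bar>(s n - S) * x ^ n\<bar>)"
        using summable_norm[of "\<lambda>n. (s n - S) * x ^ n"] sm by simp
      also have "\<dots> \<le> (\<Sum>n. (if n < N then \<bar>s n - S\<bar> else 0) + e / 2 * x ^ n)"
      proof (rule suminf_le[OF _ sm])
        show "\<bar>(s n - S) * x ^ n\<bar> \<le> (if n < N then \<bar>s n - S\<bar> else 0) + e / 2 * x ^ n" for n
        proof (cases "n < N")
          case True
          have "\<bar>s n - S\<bar> * x ^ n \<le> \<bar>s n - S\<bar> * 1"
            using x by (intro mult_left_mono power_le_one) auto
          then show ?thesis using True e x by (auto simp: abs_mult intro!: add_increasing2)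
        next
          case False
          then have "\<bar>s n - S\<bar> * x ^ n \<le> e / 2 * x ^ n"
            using N[of n] x by (intro mult_right_mono) auto
          then show ?thesis using False x by (simp add: abs_mult)
        qed
        show "summable (\<lambda>n. (if n < N then \<bar>s n - S\<bar> else 0) + e / 2 * x ^ n)"
          using x by (intro summable_add summable_mult summable_geometric
              summable_finite[of "{..<N}"]) auto
      qed
      also have "\<dots> = C + e / 2 / (1 - x)"
      proof -
        have "(\<lambda>n. if n < N then \<bar>s n - S\<bar> else 0) sums C"
          using sums_If_finite[of "\<lambda>n. n < N" "\<lambda>n. \<bar>s n - S\<bar>"]
          by (simp add: C_def lessThan_def)
        from sums_add[OF this sums_mult[OF geo, of "e/2"]] show ?thesis
          by (simp add: sums_iff)
      qed
      finally have "(1 - x) * \<bar>\<Sum>n. (s n - S) * x ^ n\<bar> \<le> (1 - x) * (C + e / 2 / (1 - x))"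
        using x by (intro mult_left_mono) auto
      also have "\<dots> = (1 - x) * C + e / 2" using x by (simp add: field_simps)
      also have "\<dots> < e" using elim by simp
      finally show ?case
        using by_parts[OF x] x by (simp add: dist_real_def abs_mult)
    qed
  qed
qed

section \<open>Iterated integrals as power series\<close>

fun form :: "letter \<Rightarrow> real \<Rightarrow> real" where
  "form Omega_m1 x = 2 / (1 + x\<^sup>2)"
| "form Omega_0 x = 1 / x"
| "form Omega_1 x = 2 / (1 - x\<^sup>2)"

text \<open>
  The Taylor series of \<open>2 / (1 - t x\<^sup>2)\<close>.
\<close>

definition kernel :: "real \<Rightarrow> real fps" where
  "kernel t = Abs_fps (\<lambda>m. if even m then 2 * t ^ (m div 2) else 0)"

text \<open>
  The iterated integral of a word from \<open>0\<close> to \<open>x\<close>, as a power series in \<open>x\<close>. Words are read here with the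
  outermost letter first, so that integrating once more is consing a letter; a word of an index therefore
  appears reversed. The division by \<open>x\<close> for \<open>Omega_0\<close> is a shift of the coefficients, which is the true
  quotient only if the constant coefficient vanishes.
\<close>

primrec iter :: "letter list \<Rightarrow> real fps" where
  "iter [] = 1"
| "iter (a # v) = fps_integral0 (case a of
      Omega_m1 \<Rightarrow> kernel (- 1) * iter v
    | Omega_0 \<Rightarrow> fps_shift 1 (iter v)
    | Omega_1 \<Rightarrow> kernel 1 * iter v)"

lemma kernel_recurrence: "(1 - fps_const t * fps_X ^ 2) * kernel t = 2"
proof (rule fps_ext)
  fix n
  consider "n = 0" | "n = 1" | m where "n = Suc (Suc m)"
    by (metis One_nat_def not0_implies_Suc)
  then show "fps_nth ((1 - fps_const t * fps_X ^ 2) * kernel t) n = fps_nth 2 n"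
    by cases (simp_all add: kernel_def algebra_simps fps_X_power_mult_nth numeral_fps_const)
qed

lemma fps_conv_radius_dominated:
  fixes f g :: "real fps"
  assumes "\<And>n. \<bar>fps_nth f n\<bar> \<le> \<bar>fps_nth g n\<bar>"
  shows "fps_conv_radius f \<ge> fps_conv_radius g"
  unfolding fps_conv_radius_def
proof (rule conv_radius_geI_ex')
  fix r :: real assume r: "r > 0" "ereal r < conv_radius (fps_nth g)"
  have "summable (\<lambda>n. norm (fps_nth g n * r ^ n))"
    using r by (intro abs_summable_in_conv_radius) auto
  then show "summable (\<lambda>n. fps_nth f n * of_real r ^ n)"
    by (rule summable_comparison_test') (use assms r in \<open>auto simp: abs_mult intro!: mult_right_mono\<close>)
qed

lemma fps_conv_radius_bounded:
  fixes f :: "real fps"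
  assumes "\<And>n. \<bar>fps_nth f n\<bar> \<le> B"
  shows "fps_conv_radius f \<ge> 1"
  unfolding fps_conv_radius_def
proof (rule conv_radius_geI_ex')
  fix r :: real assume r: "r > 0" "ereal r < 1"
  have "summable (\<lambda>n. B * r ^ n)"
    using r by (intro summable_mult summable_geometric) auto
  then show "summable (\<lambda>n. fps_nth f n * of_real r ^ n)"
    by (rule summable_comparison_test') (use assms r in \<open>auto simp: abs_mult intro!: mult_right_mono\<close>)
qed

lemma fps_conv_radius_integral:
  fixes f :: "real fps"
  shows "fps_conv_radius (fps_integral0 f) \<ge> fps_conv_radius f"
proof -
  have "fps_conv_radius (fps_shift 1 (fps_integral0 f)) \<ge> fps_conv_radius f"
  proof (rule fps_conv_radius_dominated)
    fix n
    have "\<bar>fps_nth f n\<bar> * 1 \<le> \<bar>fps_nth f n\<bar> * real (Suc n)"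
      by (rule mult_left_mono) auto
    then show "\<bar>fps_nth (fps_shift 1 (fps_integral0 f)) n\<bar> \<le> \<bar>fps_nth f n\<bar>"
      by (simp add: abs_mult field_simps)
  qed
  then show ?thesis by simp
qed

lemma kernel_conv_radius:
  assumes "\<bar>t\<bar> = 1"
  shows "fps_conv_radius (kernel t) \<ge> 1"
  by (rule fps_conv_radius_bounded[of _ 2]) (simp add: kernel_def abs_mult power_abs assms)

lemma iter_conv_radius: "fps_conv_radius (iter u) \<ge> 1"
proof (induction u)
  case Nil
  show ?case by simp
next
  case (Cons a v)
  have "fps_conv_radius (kernel t * iter v) \<ge> 1" if "\<bar>t\<bar> = 1" for t
    using fps_conv_radius_mult[of "kernel t" "iter v"] kernel_conv_radius[OF that] Cons
    by (meson min.boundedI order.trans)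
  then have "fps_conv_radius (case a of
      Omega_m1 \<Rightarrow> kernel (- 1) * iter v
    | Omega_0 \<Rightarrow> fps_shift 1 (iter v)
    | Omega_1 \<Rightarrow> kernel 1 * iter v) \<ge> 1"
    using Cons by (cases a) auto
  then show ?case
    using fps_conv_radius_integral order.trans by (simp only: iter.simps) blast
qed

lemma less_iter_conv_radius: "\<bar>x\<bar> < 1 \<Longrightarrow> ereal \<bar>x\<bar> < fps_conv_radius (iter u)"
  using iter_conv_radius[of u] by (simp add: less_le_trans flip: ereal_less(3))

lemma eval_kernel:
  assumes "\<bar>t\<bar> = 1" "\<bar>x\<bar> < 1"
  shows "eval_fps (kernel t) x = 2 / (1 - t * x\<^sup>2)"
proof -
  let ?p = "1 - fps_const t * fps_X ^ 2"
  have t: "t \<noteq> 0" using assms by auto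
  have r: "fps_conv_radius (fps_const t * fps_X ^ 2 :: real fps) = \<infinity>"
    using t by (simp add: fps_conv_radius_cmult_left)
  have "fps_conv_radius ?p = \<infinity>"
    using fps_conv_radius_diff[of 1 "fps_const t * fps_X ^ 2"] r by simp
  moreover have "ereal \<bar>x\<bar> < fps_conv_radius (kernel t)"
    using kernel_conv_radius[OF assms(1)] assms(2) by (simp add: less_le_trans flip: ereal_less(3))
  ultimately have "eval_fps (?p * kernel t) x = eval_fps ?p x * eval_fps (kernel t) x"
    by (intro eval_fps_mult) auto
  moreover have "eval_fps ?p x = 1 - t * x\<^sup>2"
    using r by (simp add: eval_fps_diff eval_fps_mult)
  ultimately have "2 = (1 - t * x\<^sup>2) * eval_fps (kernel t) x"
    by (simp add: kernel_recurrence)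
  moreover have "1 - t * x\<^sup>2 \<noteq> 0"
  proof
    assume "1 - t * x\<^sup>2 = 0"
    then have "\<bar>t\<bar> * \<bar>x\<bar>\<^sup>2 = 1"
      by (metis abs_mult abs_one eq_iff_diff_eq_0 power_abs)
    then show False using assms by (auto simp: abs_square_eq_1)
  qed
  ultimately show ?thesis by (simp add: field_simps)
qed

text \<open>
  The words whose innermost letter is integrable at \<open>0\<close>.
\<close>

definition regular :: "letter list \<Rightarrow> bool" where
  "regular u \<longleftrightarrow> u = [] \<or> last u \<noteq> Omega_0"

lemma iter_nth_0: "u \<noteq> [] \<Longrightarrow> fps_nth (iter u) 0 = 0"
  by (cases u) auto

lemma iter_deriv:
  assumes "regular (a # v)" "0 < x" "x < 1"
  shows "(eval_fps (iter (a # v)) has_real_derivative form a x * eval_fps (iter v) x) (at x)"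
proof -
  let ?d = "case a of
      Omega_m1 \<Rightarrow> kernel (- 1) * iter v
    | Omega_0 \<Rightarrow> fps_shift 1 (iter v)
    | Omega_1 \<Rightarrow> kernel 1 * iter v"
  have x: "\<bar>x\<bar> < 1" using assms by simp
  have k: "eval_fps (kernel t * iter v) x = 2 / (1 - t * x\<^sup>2) * eval_fps (iter v) x"
    if "\<bar>t\<bar> = 1" for t
  proof -
    have "ereal \<bar>x\<bar> < fps_conv_radius (kernel t)"
      using kernel_conv_radius[OF that] x by (simp add: less_le_trans flip: ereal_less(3))
    then show ?thesis
      using less_iter_conv_radius[OF x] eval_kernel[OF that x] by (simp add: eval_fps_mult)
  qed
  have "eval_fps ?d x = form a x * eval_fps (iter v) x"
  proof (cases a)
    case Omega_0
    then have "v \<noteq> []" using assms(1) by (auto simp: regular_def)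
    then have "iter v = 0 \<or> 1 \<le> subdegree (iter v)"
      using iter_nth_0[of v] by (metis One_nat_def Suc_leI neq0_conv subdegree_eq_0_iff)
    then show ?thesis
      using less_iter_conv_radius[OF x, of v] assms Omega_0 by (auto simp: eval_fps_shift)
  qed (use k[of 1] k[of "-1"] in auto)
  moreover have "fps_deriv (iter (a # v)) = ?d"
    by (simp add: fps_deriv_fps_integral)
  ultimately show ?thesis
    using has_field_derivative_eval_fps[of x "iter (a # v)"] less_iter_conv_radius[OF x, of "a # v"]
    by simp
qed

section \<open>Duality of iterated integrals\<close>

lemma regular_Cons: "regular (a # v) \<Longrightarrow> regular v"
  by (auto simp: regular_def)

lemma powr_tendsto_0_at_1:
  assumes "e > 0"
  shows "((\<lambda>x::real. (1 - x) powr e) \<longlongrightarrow> 0) (at_left 1)"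
proof -
  have "((\<lambda>x::real. (1 - x) powr e) \<longlongrightarrow> (1 - 1) powr e) (at_left 1)"
    using assms
    by (intro tendsto_powr' tendsto_intros) (auto simp: eventually_at_filter)
  then show ?thesis using assms by simp
qed

text \<open>
  By l'Hopital's rule, the quotient of \<open>eval_fps (iter (a # v)) x\<close> by \<open>(1 - x) powr (- e)\<close> is governed by that of the
  derivatives. Each form has at most a simple pole at \<open>1\<close>, which compensates the extra factor \<open>1 - x\<close>
  coming from the derivative of the power, so that the claim for \<open>v\<close> with the same \<open>e\<close> suffices. For the
  empty word it is the decay of the power.
\<close>

lemma iter_growth:
  assumes "regular u" "e > 0"
  shows "((\<lambda>x. eval_fps (iter u) x * (1 - x) powr e) \<longlongrightarrow> 0) (at_left 1)"
  using assms
proof (induction u arbitrary: e)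
  case Nil
  then show ?case using powr_tendsto_0_at_1 by simp
next
  case (Cons a v)
  let ?g = "\<lambda>x::real. (1 - x) powr (- e)"
  have interval: "\<forall>\<^sub>F x in at_left (1::real). x \<in> {1/2<..<1}"
    by (rule eventually_at_left_real) simp
  have IH: "((\<lambda>x. eval_fps (iter v) x * (1 - x) powr e) \<longlongrightarrow> 0) (at_left 1)"
    using Cons regular_Cons by blast
  have "((\<lambda>x. eval_fps (iter (a # v)) x / ?g x) \<longlongrightarrow> 0) (at_left 1)"
  proof (rule lhopital_left_at_top)
    have "\<forall>\<^sub>F x in at_left (1::real). 0 < (1 - x) powr e"
      using interval by eventually_elim auto
    then show "filterlim ?g at_top (at_left 1)"
      unfolding powr_minus using Cons.prems by (intro filterlim_inverse_at_top powr_tendsto_0_at_1)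
    show "\<forall>\<^sub>F x in at_left 1. e * (1 - x) powr (- e - 1) \<noteq> 0"
      using interval by eventually_elim (use Cons.prems in auto)
    show "\<forall>\<^sub>F x in at_left 1. DERIV (eval_fps (iter (a # v))) x :> form a x * eval_fps (iter v) x"
      using interval by eventually_elim (use Cons.prems in \<open>intro iter_deriv, auto\<close>)
    show "\<forall>\<^sub>F x in at_left 1. DERIV ?g x :> e * (1 - x) powr (- e - 1)"
      using interval by eventually_elim (auto intro!: derivative_eq_intros)
    have bound: "\<bar>form a x * (1 - x)\<bar> \<le> 2" if "x \<in> {1/2<..<1}" for x
    proof (cases a)
      case Omega_0
      then show ?thesis using that by (simp add: field_simps)
    next
      case Omega_m1
      have "2 * (1 - x) / (1 + x\<^sup>2) \<le> 2 / 1"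
        using that by (intro frac_le) auto
      moreover have "1 + x\<^sup>2 > 0" by (simp add: add_pos_nonneg)
      ultimately show ?thesis using that Omega_m1 by (simp add: abs_mult)
    next
      case Omega_1
      have "2 / (p * q) * p = 2 / q" if "p \<noteq> 0" for p q :: real
        using that by simp
      moreover have "1 - x\<^sup>2 = (1 - x) * (1 + x)"
        by (simp add: power2_eq_square algebra_simps)
      ultimately have "form a x * (1 - x) = 2 / (1 + x)"
        using that Omega_1 by (metis diff_gt_0_iff_gt form.simps(3) greaterThanLessThan_iff less_irrefl)
      moreover have "\<bar>2 / (1 + x)\<bar> \<le> 2" using that by (simp add: field_simps)
      ultimately show ?thesis by (simp only:)
    qed
    have dominating: "((\<lambda>x. 2 / e * (eval_fps (iter v) x * (1 - x) powr e)) \<longlongrightarrow> 0) (at_left 1)"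
      by (rule tendsto_mult_right_zero[OF IH])
    show "((\<lambda>x. form a x * eval_fps (iter v) x / (e * (1 - x) powr (- e - 1))) \<longlongrightarrow> 0) (at_left 1)"
    proof (rule Lim_null_comparison[OF _ tendsto_rabs_zero[OF dominating]])
      show "\<forall>\<^sub>F x in at_left 1. norm (form a x * eval_fps (iter v) x / (e * (1 - x) powr (- e - 1)))
          \<le> \<bar>2 / e * (eval_fps (iter v) x * (1 - x) powr e)\<bar>"
        using interval
      proof eventually_elim
        case (elim x)
        have "(1 - x) powr (- e - 1) = 1 / ((1 - x) powr e * (1 - x))"
          using elim by (simp add: powr_diff powr_minus_divide)
        then have "form a x * eval_fps (iter v) x / (e * (1 - x) powr (- e - 1))
            = form a x * (1 - x) * (1 / e * (eval_fps (iter v) x * (1 - x) powr e))"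
          by simp
        also have "\<bar>\<dots>\<bar> \<le> 2 * \<bar>1 / e * (eval_fps (iter v) x * (1 - x) powr e)\<bar>"
          unfolding abs_mult[of "form a x * (1 - x)"] by (intro mult_right_mono bound elim) auto
        finally show ?case by (simp add: abs_mult)
      qed
    qed
  qed
  then show ?case by (simp add: powr_minus_divide)
qed

lemma iter_linear_at_0:
  assumes "v \<noteq> []"
  obtains c where "\<forall>\<^sub>F y in at_right 0. \<bar>eval_fps (iter v) y\<bar> \<le> c * y"
proof -
  let ?f = "eval_fps (iter v)"
  have "(?f has_real_derivative eval_fps (fps_deriv (iter v)) 0) (at 0)"
    using has_field_derivative_eval_fps[of 0 "iter v"] less_iter_conv_radius[of 0 v] by simp
  then have "((\<lambda>y. ?f y / y) \<longlongrightarrow> eval_fps (fps_deriv (iter v)) 0) (at 0)"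
    using iter_nth_0[OF assms] by (simp add: DERIV_def eval_fps_at_0)
  then have "((\<lambda>y. \<bar>?f y / y\<bar>) \<longlongrightarrow> \<bar>eval_fps (fps_deriv (iter v)) 0\<bar>) (at_right 0)"
    by (rule tendsto_mono[OF at_le[OF subset_UNIV] tendsto_rabs])
  then have "\<forall>\<^sub>F y in at_right 0. \<bar>?f y / y\<bar> < \<bar>eval_fps (fps_deriv (iter v)) 0\<bar> + 1"
    by (rule order_tendstoD) simp
  moreover have "\<forall>\<^sub>F y in at_right (0::real). y > 0"
    by (auto simp: eventually_at_filter)
  ultimately have "\<forall>\<^sub>F y in at_right 0. \<bar>?f y\<bar> \<le> (\<bar>eval_fps (fps_deriv (iter v)) 0\<bar> + 1) * y"
    by eventually_elim (simp add: field_simps abs_mult)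
  then show ?thesis using that by blast
qed

definition flip :: "real \<Rightarrow> real" where
  "flip x = (1 - x) / (1 + x)"

lemma flip_flip: "x > 0 \<Longrightarrow> flip (flip x) = x"
  by (simp add: flip_def field_simps)

lemma flip_interval: "0 < x \<Longrightarrow> x < 1 \<Longrightarrow> 0 < flip x \<and> flip x < 1"
  by (simp add: flip_def field_simps)

lemma filterlim_flip_left: "filterlim flip (at_right 0) (at_left 1)"
proof -
  have "\<forall>\<^sub>F x in at_left (1::real). x \<in> {0<..<1}"
    by (rule eventually_at_left_real) simp
  then have "\<forall>\<^sub>F x in at_left 1. flip x \<in> {0<..} \<and> flip x \<noteq> 0"
    by eventually_elim (use flip_interval in force)
  moreover have "(flip \<longlongrightarrow> 0) (at_left 1)"
    unfolding flip_def by (auto intro!: tendsto_eq_intros)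
  ultimately show ?thesis
    unfolding filterlim_at by simp
qed

lemma filterlim_flip_right: "filterlim flip (at_left 1) (at_right 0)"
proof -
  have "\<forall>\<^sub>F x in at_right (0::real). x \<in> {0<..<1}"
    by (rule eventually_at_right_real) simp
  then have "\<forall>\<^sub>F x in at_right 0. flip x \<in> {..<1} \<and> flip x \<noteq> 1"
    by eventually_elim (use flip_interval in force)
  moreover have "(flip \<longlongrightarrow> 1) (at_right 0)"
    unfolding flip_def by (auto intro!: tendsto_eq_intros)
  ultimately show ?thesis
    unfolding filterlim_at by simp
qed

text \<open>
  The reason why only one splitting contributes at each endpoint: since \<open>flip x\<close> is of the order of \<open>1 - x\<close>, the
  linear zero of the second factor beats the logarithmic growth of the first one.
\<close>

lemma iter_product_tendsto_0:
  assumes "regular u" "v \<noteq> []"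
  shows "((\<lambda>x. eval_fps (iter u) x * eval_fps (iter v) (flip x)) \<longlongrightarrow> 0) (at_left 1)"
proof -
  obtain c where c: "\<forall>\<^sub>F y in at_right 0. \<bar>eval_fps (iter v) y\<bar> \<le> c * y"
    using iter_linear_at_0[OF assms(2)] .
  have "((\<lambda>x. c / (1 + x) * (eval_fps (iter u) x * (1 - x) powr 1)) \<longlongrightarrow> c / (1 + 1) * 0) (at_left 1)"
    by (intro tendsto_intros iter_growth assms) auto
  then have "((\<lambda>x. \<bar>c / (1 + x) * (eval_fps (iter u) x * (1 - x) powr 1)\<bar>) \<longlongrightarrow> 0) (at_left 1)"
    by (intro tendsto_rabs_zero) simp
  then show ?thesis
  proof (rule Lim_null_comparison[rotated])
    have "\<forall>\<^sub>F x in at_left (1::real). x \<in> {0<..<1}"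
      by (rule eventually_at_left_real) simp
    moreover have "\<forall>\<^sub>F x in at_left 1. \<bar>eval_fps (iter v) (flip x)\<bar> \<le> c * flip x"
      using filterlim_flip_left c by (auto simp: filterlim_iff)
    ultimately show "\<forall>\<^sub>F x in at_left 1. norm (eval_fps (iter u) x * eval_fps (iter v) (flip x))
        \<le> \<bar>c / (1 + x) * (eval_fps (iter u) x * (1 - x) powr 1)\<bar>"
    proof eventually_elim
      case (elim x)
      have "\<bar>eval_fps (iter u) x\<bar> * \<bar>eval_fps (iter v) (flip x)\<bar> \<le> \<bar>eval_fps (iter u) x\<bar> * \<bar>c * flip x\<bar>"
        using elim by (intro mult_left_mono) auto
      also have "\<dots> = \<bar>c / (1 + x) * (eval_fps (iter u) x * (1 - x) powr 1)\<bar>"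
        using elim by (simp add: flip_def abs_mult)
      finally show ?case by (simp add: abs_mult)
    qed
  qed
qed

fun dual_letter :: "letter \<Rightarrow> letter" where
  "dual_letter Omega_m1 = Omega_m1"
| "dual_letter Omega_0 = Omega_1"
| "dual_letter Omega_1 = Omega_0"

text \<open>
  The substitution \<open>flip\<close> pulls the form of \<open>dual_letter a\<close> back to minus the form of \<open>a\<close>; the factor
  \<open>2 / (1 + x)\<^sup>2\<close> is minus the derivative of \<open>flip\<close>. The sign, which occurs once for every letter, accounts for
  the reversed direction of the path.
\<close>

lemma form_dual_letter:
  assumes "0 < x" "x < 1"
  shows "form (dual_letter a) (flip x) * (2 / (1 + x)\<^sup>2) = form a x"
proof -
  have nz: "1 + x \<noteq> 0" "1 - x \<noteq> 0" "x \<noteq> 0" using assms by auto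
  show ?thesis
  proof (cases a)
    case Omega_m1
    have "(1 - x)\<^sup>2 + (1 + x)\<^sup>2 = 2 * (1 + x\<^sup>2)" by (simp add: power2_eq_square algebra_simps)
    then have "1 + (flip x)\<^sup>2 = 2 * (1 + x\<^sup>2) / (1 + x)\<^sup>2"
      using nz by (simp add: flip_def field_simps)
    moreover have "1 + x\<^sup>2 > 0" by (simp add: add_pos_nonneg)
    ultimately show ?thesis using Omega_m1 nz by (simp add: divide_simps)
  next
    case Omega_0
    have "(1 + x)\<^sup>2 - (1 - x)\<^sup>2 = 4 * x" by (simp add: power2_eq_square algebra_simps)
    moreover have "1 = (1 + x)\<^sup>2 / (1 + x)\<^sup>2" using nz by simp
    ultimately have "1 - (flip x)\<^sup>2 = 4 * x / (1 + x)\<^sup>2"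
      unfolding flip_def by (metis power_divide diff_divide_distrib)
    then show ?thesis using Omega_0 nz by simp
  next
    case Omega_1
    have "1 / (p / q) * (2 / q\<^sup>2) = 2 / (p * q)" if "q \<noteq> 0" for p q :: real
      using that by (simp add: power2_eq_square)
    moreover have "1 - x\<^sup>2 = (1 - x) * (1 + x)" by (simp add: power2_eq_square algebra_simps)
    ultimately show ?thesis using Omega_1 nz by (metis flip_def form.simps(2,3) dual_letter.simps(3))
  qed
qed

lemma iter_dual_letter_deriv:
  assumes "regular (map dual_letter (a # v))" "0 < x" "x < 1"
  shows "((\<lambda>x. eval_fps (iter (map dual_letter (a # v))) (flip x)) has_real_derivative
      - (form a x * eval_fps (iter (map dual_letter v)) (flip x))) (at x)"
proof -
  have "(flip has_real_derivative - (2 / (1 + x)\<^sup>2)) (at x)"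
    unfolding flip_def using assms
    by (auto intro!: derivative_eq_intros simp: power2_eq_square)
  then have "((\<lambda>x. eval_fps (iter (map dual_letter (a # v))) (flip x)) has_real_derivative
      form (dual_letter a) (flip x) * eval_fps (iter (map dual_letter v)) (flip x) * - (2 / (1 + x)\<^sup>2)) (at x)"
    using iter_deriv[of "dual_letter a" "map dual_letter v" "flip x"] assms flip_interval[of x]
    by (intro DERIV_chain2[of "eval_fps (iter (map dual_letter (a # v)))" _ flip]) auto
  moreover have "form (dual_letter a) (flip x) * eval_fps (iter (map dual_letter v)) (flip x) * - (2 / (1 + x)\<^sup>2)
     = - (form a x * eval_fps (iter (map dual_letter v)) (flip x))"
    unfolding form_dual_letter[OF assms(2,3), of a, symmetric] by (simp add: algebra_simps)
  ultimately show ?thesis by simp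
qed

text \<open>
  The sum over all splittings of a word: letters travel from the inner part \<open>u\<close> to the accumulator \<open>v\<close>, which
  holds the outer part with its innermost letter first. By the substitution \<open>flip\<close>, the integral of the outer part from
  \<open>x\<close> to \<open>1\<close> is the series of \<open>map dual_letter v\<close> at \<open>flip x\<close>.
\<close>

primrec path_sum :: "letter list \<Rightarrow> letter list \<Rightarrow> real \<Rightarrow> real" where
  "path_sum [] v x = eval_fps (iter (map dual_letter v)) (flip x)"
| "path_sum (a # u) v x =
     eval_fps (iter (a # u)) x * eval_fps (iter (map dual_letter v)) (flip x) + path_sum u (a # v) x"

text \<open>
  In the product rule for one splitting, the term from the inner part removes the outermost letter of \<open>u\<close>,
  the term from the outer part removes the head of \<open>v\<close> with a minus sign. So the former cancels against the latter of
  the next splitting, where this letter has become the head of the accumulator. What survives is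
  the negative term of the first splitting, which is absent when the accumulator starts empty.
\<close>

lemma path_sum_deriv:
  assumes "regular u" "regular (map dual_letter (rev u @ v))" "0 < x" "x < 1"
  shows "(path_sum u v has_real_derivative
    (case v of [] \<Rightarrow> 0 | b # v' \<Rightarrow>
       - (eval_fps (iter u) x * (form b x * eval_fps (iter (map dual_letter v')) (flip x))))) (at x)"
proof -
  have reg: "regular (map dual_letter v)" if "regular (map dual_letter (rev u @ v))" for u v
    using that by (auto simp: regular_def)
  have D: "((\<lambda>x. eval_fps (iter (map dual_letter v)) (flip x)) has_real_derivative
      (case v of [] \<Rightarrow> 0 | b # v' \<Rightarrow> - (form b x * eval_fps (iter (map dual_letter v')) (flip x)))) (at x)"
    if "regular (map dual_letter v)" for v
    using iter_dual_letter_deriv[of _ _ x] that assms(3,4) by (cases v) auto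
  show ?thesis
    using assms(1,2)
  proof (induction u arbitrary: v)
    case Nil
    have "path_sum [] v = (\<lambda>x. eval_fps (iter (map dual_letter v)) (flip x))" by auto
    then show ?case using D[of v] Nil by (auto split: list.split)
  next
    case (Cons a u)
    have "path_sum (a # u) v =
        (\<lambda>x. eval_fps (iter (a # u)) x * eval_fps (iter (map dual_letter v)) (flip x) + path_sum u (a # v) x)"
      by auto
    moreover have "(path_sum u (a # v) has_real_derivative
       - (eval_fps (iter u) x * (form a x * eval_fps (iter (map dual_letter v)) (flip x)))) (at x)"
      using Cons.IH[of "a # v"] Cons.prems regular_Cons by auto
    note DERIV_add[OF DERIV_mult[OF iter_deriv[OF Cons.prems(1) assms(3,4)] D[OF reg[OF Cons.prems(2)]]] this]
    ultimately show ?case by (auto split: list.split simp: algebra_simps)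
  qed
qed

lemma path_sum_tendsto_0_at_1:
  assumes "regular u" "v \<noteq> []"
  shows "(path_sum u v \<longlongrightarrow> 0) (at_left 1)"
  using assms
proof (induction u arbitrary: v)
  case Nil
  have "path_sum [] v = (\<lambda>x. eval_fps (iter []) x * eval_fps (iter (map dual_letter v)) (flip x))"
    by auto
  then show ?case using iter_product_tendsto_0[of "[]" "map dual_letter v"] Nil by simp
next
  case (Cons a u)
  have "path_sum (a # u) v =
      (\<lambda>x. eval_fps (iter (a # u)) x * eval_fps (iter (map dual_letter v)) (flip x) + path_sum u (a # v) x)"
    by auto
  then show ?case
    using tendsto_add[OF iter_product_tendsto_0[of "a # u" "map dual_letter v"] Cons.IH[of "a # v"]]
      Cons.prems regular_Cons by auto
qed

lemma path_sum_at_0: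
  assumes "regular (map dual_letter (rev u @ v))"
  shows "((\<lambda>x. path_sum u v x - eval_fps (iter (map dual_letter (rev u @ v))) (flip x)) \<longlongrightarrow> 0) (at_right 0)"
  using assms
proof (induction u arbitrary: v)
  case Nil
  then show ?case by simp
next
  case (Cons a u)
  \<comment> \<open>The behaviour at \<open>0\<close> is the one at \<open>1\<close> with the two factors exchanged, because \<open>flip\<close> is an involution.\<close>
  have "regular (map dual_letter v)" using Cons.prems by (auto simp: regular_def)
  then have "((\<lambda>x. eval_fps (iter (map dual_letter v)) x * eval_fps (iter (a # u)) (flip x)) \<longlongrightarrow> 0) (at_left 1)"
    by (intro iter_product_tendsto_0) auto
  from filterlim_compose[OF this filterlim_flip_right]
  have "((\<lambda>x. eval_fps (iter (map dual_letter v)) (flip x) * eval_fps (iter (a # u)) (flip (flip x))) \<longlongrightarrow> 0) (at_right 0)" .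
  moreover have "\<forall>\<^sub>F x in at_right (0::real). x > 0"
    by (auto simp: eventually_at_filter)
  then have "\<forall>\<^sub>F x in at_right 0. eval_fps (iter (map dual_letter v)) (flip x) * eval_fps (iter (a # u)) (flip (flip x))
      = eval_fps (iter (a # u)) x * eval_fps (iter (map dual_letter v)) (flip x)"
    by eventually_elim (simp add: flip_flip)
  ultimately have "((\<lambda>x. eval_fps (iter (a # u)) x * eval_fps (iter (map dual_letter v)) (flip x)) \<longlongrightarrow> 0) (at_right 0)"
    by (rule Lim_transform_eventually)
  moreover have "((\<lambda>x. path_sum u (a # v) x - eval_fps (iter (map dual_letter (rev u @ a # v))) (flip x)) \<longlongrightarrow> 0) (at_right 0)"
    using Cons.IH[of "a # v"] Cons.prems by simp
  ultimately have "((\<lambda>x. eval_fps (iter (a # u)) x * eval_fps (iter (map dual_letter v)) (flip x)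
      + (path_sum u (a # v) x - eval_fps (iter (map dual_letter (rev u @ a # v))) (flip x))) \<longlongrightarrow> 0) (at_right 0)"
    by (rule tendsto_add_zero)
  then show ?case
    unfolding path_sum.simps rev.simps append_assoc append.simps add_diff_eq .
qed

text \<open>
  The constant function \<open>path_sum u []\<close> is evaluated at both ends of the interval. At \<open>1\<close> only the splitting
  with empty outer part survives, at \<open>0\<close> only the one with empty inner part.
\<close>

theorem iterated_integral_duality:
  assumes "regular u" "regular (map dual_letter (rev u))"
    and lim: "(eval_fps (iter u) \<longlongrightarrow> L) (at_left 1)"
  shows "(eval_fps (iter (map dual_letter (rev u))) \<longlongrightarrow> L) (at_left 1)"
proof (cases u)
  case Nil
  then show ?thesis using lim by simp
next
  case (Cons a u')
  have const: "path_sum u [] x = path_sum u [] (1/2)" if "x \<in> {0<..<1}" for x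
  proof (rule has_field_derivative_zero_constant[of "{0<..<1::real}" "path_sum u []", THEN exE])
    show "(path_sum u [] has_real_derivative 0) (at x within {0<..<1})" if "x \<in> {0<..<1}" for x
      using path_sum_deriv[of u "[]" x] assms that by (auto intro: has_field_derivative_at_within)
  qed (use that in auto)
  let ?C = "path_sum u [] (1/2)"
  have "path_sum u [] = (\<lambda>x. eval_fps (iter u) x + path_sum u' [a] x)"
    using Cons by auto
  moreover have "((\<lambda>x. eval_fps (iter u) x + path_sum u' [a] x) \<longlongrightarrow> L + 0) (at_left 1)"
    using assms(1) Cons regular_Cons by (intro tendsto_add lim path_sum_tendsto_0_at_1) auto
  ultimately have "(path_sum u [] \<longlongrightarrow> L) (at_left 1)" by simp
  moreover have "\<forall>\<^sub>F x in at_left (1::real). x \<in> {0<..<1}"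
    by (rule eventually_at_left_real) simp
  then have "\<forall>\<^sub>F x in at_left 1. path_sum u [] x = ?C"
    by eventually_elim (rule const)
  ultimately have "((\<lambda>_. ?C) \<longlongrightarrow> L) (at_left (1::real))"
    by (rule Lim_transform_eventually)
  then have C: "?C = L"
    using tendsto_unique[OF _ tendsto_const] by (metis trivial_limit_at_left_real)
  have "((\<lambda>x. L - (path_sum u [] x - eval_fps (iter (map dual_letter (rev u))) (flip x))) \<longlongrightarrow> L - 0) (at_right 0)"
    using path_sum_at_0[of u "[]"] assms by (intro tendsto_intros) simp
  moreover have "\<forall>\<^sub>F x in at_right (0::real). x \<in> {0<..<1}"
    by (rule eventually_at_right_real) simp
  then have "\<forall>\<^sub>F x in at_right 0. L - (path_sum u [] x - eval_fps (iter (map dual_letter (rev u))) (flip x))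
      = eval_fps (iter (map dual_letter (rev u))) (flip x)"
    by eventually_elim (simp add: const C)
  ultimately have "((\<lambda>x. eval_fps (iter (map dual_letter (rev u))) (flip x)) \<longlongrightarrow> L) (at_right 0)"
    using Lim_transform_eventually by fastforce
  from filterlim_compose[OF this filterlim_flip_left]
  have "((\<lambda>x. eval_fps (iter (map dual_letter (rev u))) (flip (flip x))) \<longlongrightarrow> L) (at_left 1)" .
  moreover have "\<forall>\<^sub>F x in at_left (1::real). x \<in> {0<..<1}"
    by (rule eventually_at_left_real) simp
  then have "\<forall>\<^sub>F x in at_left 1. eval_fps (iter (map dual_letter (rev u))) (flip (flip x))
      = eval_fps (iter (map dual_letter (rev u))) x"
    by eventually_elim (simp add: flip_flip)
  ultimately show ?thesis by (rule Lim_transform_eventually)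
qed

section \<open>Recursion for the truncated sums\<close>

text \<open>
  The summation range of \<open>T_partial\<close>, with the length of the index as a parameter of its own so that it can be
  decomposed by its last entry.
\<close>

definition chains :: "nat \<Rightarrow> nat \<Rightarrow> nat list set" where
  "chains r N = {ns. length ns = r \<and> sorted_wrt (<) ns \<and> set ns \<subseteq> {1..N}}"

lemma finite_chains: "finite (chains r N)"
  unfolding chains_def
  by (rule finite_subset[OF _ finite_lists_length_eq[of "{1..N}" r]]) auto

lemma sum_chains_Suc:
  "(\<Sum>ns \<in> chains (Suc r) N. f ns) = (\<Sum>n = 1..N. \<Sum>ns \<in> chains r (n - 1). f (ns @ [n]))"
proof -
  have "(\<Sum>n = 1..N. \<Sum>ns \<in> chains r (n - 1). f (ns @ [n]))
      = (\<Sum>(n, ns) \<in> (SIGMA n : {1..N}. chains r (n - 1)). f (ns @ [n]))"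
    by (rule sum.Sigma) (auto simp: finite_chains)
  also have "\<dots> = (\<Sum>ns \<in> chains (Suc r) N. f ns)"
  proof (rule sum.reindex_bij_witness[where i = "\<lambda>ns. (last ns, butlast ns)" and j = "\<lambda>(n, ns). ns @ [n]"])
    fix ns assume ns: "ns \<in> chains (Suc r) N"
    then have "ns \<noteq> []" by (auto simp: chains_def)
    then obtain ms n where mn: "ns = ms @ [n]" by (metis append_butlast_last_id)
    then show "(last ns, butlast ns) \<in> (SIGMA n : {1..N}. chains r (n - 1))"
      using ns by (fastforce simp: chains_def sorted_wrt_append)
    show "(case (last ns, butlast ns) of (n, ns) \<Rightarrow> ns @ [n]) = ns"
      using \<open>ns \<noteq> []\<close> by simp
  next
    fix p assume "p \<in> (SIGMA n : {1..N}. chains r (n - 1))"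
    then show "(case p of (n, ns) \<Rightarrow> ns @ [n]) \<in> chains (Suc r) N"
      by (fastforce simp: chains_def sorted_wrt_append)
  qed auto
  finally show ?thesis ..
qed

lemma T_partial_Nil [simp]: "T_partial [] N = 1"
proof -
  have "{ns. length ns = length ([] :: index) \<and> sorted_wrt (<) ns \<and> set ns \<subseteq> {1..N}} = {[] :: nat list}"
    by auto
  then show ?thesis unfolding T_partial_def by simp
qed

lemma T_partial_snoc:
  "T_partial (k @ [(c, s)]) N =
    (\<Sum>n = 1..N. 2 * of_int s ^ n / (2 * real n - real (length k + 1)) ^ c * T_partial k (n - 1))"
proof -
  let ?f = "\<lambda>(k::index) ns j. of_int (snd (k ! j)) ^ (ns ! j) / (2 * real (ns ! j) - real (j + 1)) ^ fst (k ! j)"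
  have T: "T_partial k N = 2 ^ length k * (\<Sum>ns \<in> chains (length k) N. \<Prod>j<length k. ?f k ns j)" for k N
    by (simp add: T_partial_def chains_def)
  have factor: "(\<Prod>j<length (k @ [(c, s)]). ?f (k @ [(c, s)]) (ns @ [n]) j)
      = (\<Prod>j<length k. ?f k ns j) * (of_int s ^ n / (2 * real n - real (length k + 1)) ^ c)"
    if "ns \<in> chains (length k) m" for ns n m
  proof -
    have len: "length ns = length k" using that by (simp add: chains_def)
    then have "(\<Prod>j<length k. ?f (k @ [(c, s)]) (ns @ [n]) j) = (\<Prod>j<length k. ?f k ns j)"
      by (intro prod.cong) (auto simp: nth_append)
    then show ?thesis
      using len nth_append_length[of k "(c, s)" "[]"] nth_append_length[of ns n "[]"] by simp
  qed
  have "T_partial (k @ [(c, s)]) N = 2 ^ Suc (length k) *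
      (\<Sum>n = 1..N. \<Sum>ns \<in> chains (length k) (n - 1).
         \<Prod>j<length (k @ [(c, s)]). ?f (k @ [(c, s)]) (ns @ [n]) j)"
    unfolding T length_append_singleton sum_chains_Suc ..
  also have "\<dots> = 2 ^ Suc (length k) * (\<Sum>n = 1..N. \<Sum>ns \<in> chains (length k) (n - 1).
         (\<Prod>j<length k. ?f k ns j) * (of_int s ^ n / (2 * real n - real (length k + 1)) ^ c))"
    by (simp only: factor cong: sum.cong)
  also have "\<dots> = (\<Sum>n = 1..N. 2 * of_int s ^ n / (2 * real n - real (length k + 1)) ^ c * T_partial k (n - 1))"
    unfolding T by (simp add: sum_distrib_left sum_distrib_right mult_ac)
  finally show ?thesis .
qed

lemma T_partial_less_length: "n < length k \<Longrightarrow> T_partial k n = 0"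
proof (induction k arbitrary: n rule: rev_induct)
  case (snoc x k)
  obtain c s where "x = (c, s)" by (cases x)
  then show ?case
    using snoc by (auto simp: T_partial_snoc intro!: sum.neutral)
qed simp

text \<open>
  The part of the series in which the largest summation variable is \<open>n\<close>. The value at \<open>0\<close> matters only for
  the empty index, whose whole series sits there: its truncations are all \<open>1\<close>.
\<close>

definition T_term :: "index \<Rightarrow> nat \<Rightarrow> real" where
  "T_term k n = (if n = 0 then T_partial k 0 else T_partial k n - T_partial k (n - 1))"

lemma sum_T_term: "(\<Sum>i\<le>n. T_term k i) = T_partial k n"
  by (induction n) (auto simp: T_term_def)

lemma T_term_less_length: "n < length k \<Longrightarrow> T_term k n = 0"
  by (auto simp: T_term_def T_partial_less_length)

lemma T_term_snoc:
  "T_term (k @ [(c, s)]) n =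
    (if n = 0 then 0 else 2 * of_int s ^ n / (2 * real n - real (length k + 1)) ^ c * T_partial k (n - 1))"
proof (cases n)
  case (Suc m)
  then show ?thesis by (simp add: T_term_def T_partial_snoc del: of_nat_Suc)
qed (simp add: T_term_def T_partial_snoc)

section \<open>Power series coefficients of the integral of an index\<close>

text \<open>
  The word whose integral represents an index, for a reversed index and with outermost letter first. The
  letter signs are the products \<open>\<sigma>\<^sub>j \<sigma>\<^sub>j\<^sub>+\<^sub>1 \<cdots> \<sigma>\<^sub>r\<close>; the second argument collects the product of the signs read so
  far. Keeping it arbitrary is what makes inductions possible, since appending an entry to an index changes
  all letter signs by a common factor.
\<close>

primrec rword :: "index \<Rightarrow> int \<Rightarrow> letter list" where
  "rword [] s = []"
| "rword (x # k) s = replicate (fst x - 1) Omega_0 @ omega (s * snd x) # rword k (s * snd x)"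

definition word_sign :: "letter list \<Rightarrow> real" where
  "word_sign u = (\<Prod>a\<leftarrow>u. if a = Omega_m1 then - 1 else 1)"

lemma word_sign_simps [simp]:
  "word_sign [] = 1"
  "word_sign (a # u) = (if a = Omega_m1 then - 1 else 1) * word_sign u"
  "word_sign (u @ v) = word_sign u * word_sign v"
  by (simp_all add: word_sign_def)

lemma word_sign_replicate [simp]: "word_sign (replicate n Omega_0) = 1"
  by (induction n) auto

lemma iter_omega:
  assumes "t = 1 \<or> t = - 1"
  shows "iter (omega t # v) = fps_integral0 (kernel (of_int t) * iter v)"
  using assms by (auto simp: omega_def)

lemma iter_replicate_nth:
  "fps_nth (iter (replicate j Omega_0 @ a # v)) m = fps_nth (iter (a # v)) m / real m ^ j"
proof (induction j)
  case (Suc j)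
  show ?case
  proof (cases m)
    case 0
    then show ?thesis using iter_nth_0[of "a # v"] by simp
  next
    case m: (Suc m')
    then show ?thesis using Suc by (simp add: field_simps del: of_nat_Suc iter.simps(2) add: iter.simps(2)[of Omega_0])
  qed
qed simp

text \<open>
  Dividing by \<open>1 - t x\<^sup>2\<close> forms partial sums along exponents of equal parity, weighted by powers of \<open>t\<close>. When the
  coefficients are \<open>t ^ n\<close> times the terms of a series, all contributions to one coefficient carry the same
  power of \<open>t\<close>, and the truncated sums appear.
\<close>

lemma kernel_mult_nth:
  assumes t: "\<bar>t\<bar> = 1"
    and P: "\<And>m. fps_nth P m =
      (if even (m + length k) then e * t ^ ((m + length k) div 2) * T_term k ((m + length k) div 2) else 0)"
  shows "fps_nth (kernel t * P) m =
      (if even (m + length k) then 2 * e * t ^ ((m + length k) div 2) * T_partial k ((m + length k) div 2) else 0)"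
proof -
  let ?D = "kernel t * P"
  have "?D - fps_const t * (fps_X ^ 2 * ?D) = (1 - fps_const t * fps_X ^ 2) * kernel t * P"
    by (simp add: algebra_simps)
  then have eq: "?D - fps_const t * (fps_X ^ 2 * ?D) = 2 * P"
    by (simp only: kernel_recurrence)
  have rec: "fps_nth ?D m = 2 * fps_nth P m + (if m < 2 then 0 else t * fps_nth ?D (m - 2))" for m
  proof -
    have "fps_nth ?D m - t * (if m < 2 then 0 else fps_nth ?D (m - 2)) = 2 * fps_nth P m"
      using arg_cong[OF eq, of "\<lambda>f. fps_nth f m"] by (simp add: fps_X_power_mult_nth)
    then show ?thesis by (cases "m < 2") auto
  qed
  show ?thesis
  proof (induction m rule: less_induct)
    case (less m)
    let ?n = "(m + length k) div 2"
    show ?case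
    proof (cases "m < 2")
      case True
      have "T_term k ?n = T_partial k ?n" if "even (m + length k)"
      proof (cases "length k = 0")
        case True
        then have "?n = 0" using \<open>m < 2\<close> by simp
        then show ?thesis by (simp add: T_term_def)
      next
        case False
        then have "?n - 1 < length k" using \<open>m < 2\<close> by linarith
        then show ?thesis by (simp add: T_term_def T_partial_less_length)
      qed
      then show ?thesis using True by (simp add: rec[of m] P)
    next
      case False
      define m' where "m' = m - 2"
      have m: "m = m' + 2" using False by (simp add: m'_def)
      have n: "(m + length k) div 2 = Suc ((m' + length k) div 2)" by (simp add: m)
      show ?thesis
        using less[of m'] unfolding rec[of m] P n
        by (simp add: m T_term_def algebra_simps)
    qed
  qed
qed

text \<open>
  With exponent \<open>m = 2 n - length k\<close>, the coefficient is the \<open>n\<close>-th term of the series for the index, up to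
  the sign of the word and the factor \<open>s ^ n\<close> that the twist \<open>s\<close> puts on the last summation variable. In the
  inductive step the inner word is twisted by \<open>q = s * t\<close>; multiplication by the kernel of the same sign \<open>q\<close> gives all
  inner terms the common factor \<open>q ^ n\<close>, and the integration raises \<open>n\<close> by one, which leaves
  \<open>q ^ n\<close> instead of \<open>q ^ Suc n\<close> and thus adds \<open>q\<close> to the sign of the word.
\<close>

lemma iter_rword_nth:
  assumes "is_index k" "s = 1 \<or> s = - 1"
  shows "fps_nth (iter (rword (rev k) s)) m =
    (if even (m + length k)
     then word_sign (rword (rev k) s) * of_int s ^ ((m + length k) div 2) * T_term k ((m + length k) div 2)
     else 0)"
  using assms
proof (induction k arbitrary: s m rule: rev_induct)
  case Nil
  then show ?case by (cases m) (auto simp: T_term_def)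
next
  case (snoc x k)
  obtain c t where x: "x = (c, t)" by (cases x)
  have c: "c \<ge> 1" and t: "t = 1 \<or> t = - 1" and k: "is_index k"
    using snoc.prems(1) by (auto simp: x is_index_def)
  define q where "q = s * t"
  have q: "q = 1 \<or> q = - 1" using t snoc.prems(2) by (auto simp: q_def)
  let ?v = "rword (rev k) q" and ?e = "word_sign (rword (rev k) q)"
  have word: "rword (rev (k @ [x])) s = replicate (c - 1) Omega_0 @ omega q # ?v"
    by (simp add: x q_def)
  have sign: "word_sign (rword (rev (k @ [x])) s) = of_int q * ?e"
    unfolding word using q by (auto simp: omega_def)
  have D: "fps_nth (kernel (of_int q) * iter ?v) m =
      (if even (m + length k) then 2 * ?e * of_int q ^ ((m + length k) div 2) * T_partial k ((m + length k) div 2) else 0)" for m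
    using q by (intro kernel_mult_nth snoc.IH k) auto
  have nth: "fps_nth (iter (rword (rev (k @ [x])) s)) m
      = fps_nth (fps_integral0 (kernel (of_int q) * iter ?v)) m / real m ^ (c - 1)"
    unfolding word by (simp only: iter_replicate_nth iter_omega[OF q])
  show ?case
  proof (cases m)
    case 0
    show ?thesis
      using T_term_less_length[of "Suc (length k) div 2" "k @ [x]"] unfolding nth by (auto simp: 0)
  next
    case (Suc m')
    show ?thesis
    proof (cases "even (m' + length k)")
      case False
      then show ?thesis unfolding nth by (simp add: Suc D)
    next
      case True
      define n where "n = (m' + length k) div 2"
      have n: "m' + length k = 2 * n" using True by (simp add: n_def)
      have "2 * real (Suc n) - real (length k + 1) = real m"
        using arg_cong[OF n, of real] Suc by simp
      then have last_term: "T_term (k @ [x]) (Suc n) = 2 * of_int t ^ Suc n / real m ^ c * T_partial k n"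
        unfolding x T_term_snoc by simp
      have pow: "of_int q ^ n = of_int q * of_int s ^ Suc n * (of_int t ^ Suc n :: real)"
        using t snoc.prems(2) by (auto simp: q_def power_mult_distrib)
      have "fps_nth (iter (rword (rev (k @ [x])) s)) m
         = 2 * ?e * of_int q ^ n * T_partial k n / (real m * real m ^ (c - 1))"
        unfolding nth using True by (simp add: Suc D n_def field_simps del: of_nat_Suc)
      also have "real m * real m ^ (c - 1) = real m ^ c"
        using c by (cases c) auto
      also have "2 * ?e * of_int q ^ n * T_partial k n / real m ^ c
          = of_int q * ?e * of_int s ^ Suc n * T_term (k @ [x]) (Suc n)"
        unfolding last_term pow by simp
      also have "Suc n = (m + length (k @ [x])) div 2"
        using n Suc by simp
      finally show ?thesis
        unfolding sign using True Suc by simp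
    qed
  qed
qed

section \<open>Convergence and the value at 1\<close>

lemma sum_inverse_sqrt_le: "(\<Sum>n = 1..N. 1 / sqrt (real n)) \<le> 2 * sqrt (real N)"
proof (induction N)
  case (Suc N)
  let ?a = "sqrt (real N)" and ?b = "sqrt (real (Suc N))"
  have ab: "?a \<ge> 0" "?b > 0" "?a \<le> ?b" by auto
  have "(?b - ?a) * (?b + ?a) = 1"
    by (simp add: algebra_simps)
  moreover have "(?b - ?a) * (?b + ?a) \<le> (?b - ?a) * (2 * ?b)"
    using ab by (intro mult_left_mono) auto
  ultimately have "1 / ?b \<le> 2 * (?b - ?a)"
    using ab by (simp only: divide_le_eq mult_ac if_True)
  with Suc show ?case by simp
qed simp

text \<open>
  Terms with \<open>n \<le> length k\<close> vanish because there is no room for the inner summation variables; for all others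
  the denominator \<open>2 n - (length k + 1)\<close> is at least \<open>n\<close>.
\<close>

lemma T_term_snoc_bound:
  assumes "c \<ge> 1" "s = 1 \<or> s = - 1" "n \<ge> 1" and T: "\<And>n. \<bar>T_partial k n\<bar> \<le> B * sqrt (real n + 1)"
  shows "\<bar>T_term (k @ [(c, s)]) n\<bar> \<le> 2 * B * sqrt (real n) / real n ^ c"
proof (cases "n - 1 < length k")
  case True
  have "B \<ge> 0" using T[of 0] by (simp add: order.trans[OF abs_ge_zero])
  then show ?thesis using True assms(3) by (simp add: T_term_less_length)
next
  case False
  let ?d = "2 * real n - real (length k + 1)"
  have d: "?d \<ge> real n" using False assms(3) by linarith
  have Bn: "\<bar>T_partial k (n - 1)\<bar> \<le> B * sqrt (real n)"
    using T[of "n - 1"] assms(3) by (simp add: of_nat_diff)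
  have "\<bar>T_term (k @ [(c, s)]) n\<bar> = 2 * \<bar>T_partial k (n - 1)\<bar> / ?d ^ c"
    using assms d unfolding T_term_snoc by (auto simp: abs_mult power_abs)
  also have "\<dots> \<le> 2 * (B * sqrt (real n)) / real n ^ c"
    using Bn d assms(3) by (intro frac_le power_mono mult_left_mono) (auto intro: order.trans[OF abs_ge_zero])
  finally show ?thesis by simp
qed

text \<open>
  A crude bound: the true growth is at most a power of \<open>ln n\<close>, but any exponent below \<open>1\<close> is enough for
  convergence, and the square root reproduces itself under summation, up to a factor of 4.
\<close>

lemma T_partial_bound:
  assumes "is_index k"
  shows "\<bar>T_partial k n\<bar> \<le> 4 ^ length k * sqrt (real n + 1)"
  using assms
proof (induction k arbitrary: n rule: rev_induct)
  case Nil
  then show ?case by simp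
next
  case (snoc x k)
  obtain c s where x: "x = (c, s)" by (cases x)
  have cs: "c \<ge> 1" "s = 1 \<or> s = - 1" and k: "is_index k"
    using snoc.prems by (auto simp: x is_index_def)
  have last_term: "\<bar>T_term (k @ [x]) i\<bar> \<le> 2 * 4 ^ length k * (1 / sqrt (real i))" if "i \<ge> 1" for i
  proof -
    have "\<bar>T_term (k @ [x]) i\<bar> \<le> 2 * 4 ^ length k * sqrt (real i) / real i ^ c"
      unfolding x using T_term_snoc_bound[OF cs that snoc.IH] k by blast
    also have "\<dots> \<le> 2 * 4 ^ length k * sqrt (real i) / real i"
      using that cs self_le_power[of "real i" c] by (intro divide_left_mono) auto
    also have "\<dots> = 2 * 4 ^ length k * (1 / sqrt (real i))"
      using that by (simp add: real_div_sqrt field_simps)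
    finally show ?thesis .
  qed
  have "T_partial (k @ [x]) n = (\<Sum>i = 1..n. T_term (k @ [x]) i)"
    unfolding sum_T_term[symmetric] by (rule sum.mono_neutral_right) (auto simp: T_term_less_length not_le)
  then have "\<bar>T_partial (k @ [x]) n\<bar> \<le> (\<Sum>i = 1..n. 2 * 4 ^ length k * (1 / sqrt (real i)))"
    using last_term by (auto intro!: order.trans[OF sum_abs] sum_mono)
  also have "\<dots> \<le> 2 * 4 ^ length k * (2 * sqrt (real n))"
    unfolding sum_distrib_left[symmetric] using sum_inverse_sqrt_le[of n] by (intro mult_left_mono) auto
  also have "\<dots> \<le> 2 * 4 ^ length k * (2 * sqrt (real n + 1))"
    by (intro mult_left_mono) auto
  finally show ?case by simp
qed

text \<open>
  Twice the series is the sum of the given series of consecutive pairs and a telescoping one.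
\<close>

lemma summable_of_pairs:
  fixes a :: "nat \<Rightarrow> real"
  assumes "a \<longlonglongrightarrow> 0" "summable (\<lambda>n. a n + a (Suc n))"
  shows "summable a"
proof -
  have "summable (\<lambda>n. (a n - a (Suc n)) + (a n + a (Suc n)))"
    by (intro summable_add assms telescope_summable'[OF assms(1)])
  then have "summable (\<lambda>n. 2 * a n)" by simp
  then show ?thesis by simp
qed

lemma summable_three_halves: "summable (\<lambda>n. B * (sqrt (real n) / real n ^ 2))"
proof -
  have "(\<lambda>n. real n powr (- 3 / 2)) = (\<lambda>n. sqrt (real n) / real n ^ 2)"
  proof
    fix n
    have "real n powr (- 3 / 2) = real n powr (1 / 2 - 2)" by simp
    also have "\<dots> = sqrt (real n) / real n ^ 2"
      unfolding powr_diff by (cases "n = 0") (auto simp: powr_half_sqrt powr_numeral)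
    finally show "real n powr (- 3 / 2) = sqrt (real n) / real n ^ 2" .
  qed
  then show ?thesis
    using summable_real_powr_iff[of "- 3 / 2"] by (intro summable_mult) simp
qed

text \<open>
  For \<open>c \<ge> 2\<close> the terms are \<open>O(n powr (- 3 / 2))\<close>. For \<open>c = 1\<close> the sign is \<open>- 1\<close>, and the sum of two consecutive
  terms is, up to a factor \<open>2\<close> or \<open>- 2\<close>, the change of \<open>T_partial k' (n - 1) / (2 n - r)\<close> in \<open>n\<close>. This is again \<open>O(n powr (- 3 / 2))\<close>, since
  the numerator is \<open>O(sqrt n)\<close> and its own change \<open>T_term k' n\<close> is \<open>O(1 / sqrt n)\<close>.
\<close>

lemma summable_T_term:
  assumes "k \<noteq> []" "is_index k" "last k \<noteq> (1, 1)"
  shows "summable (T_term k)"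
proof -
  obtain k' c s where k: "k = k' @ [(c, s)]"
    using assms(1) by (metis append_butlast_last_id surj_pair)
  have cs: "c \<ge> 1" "s = 1 \<or> s = - 1" and k': "is_index k'"
    using assms(2) by (auto simp: k is_index_def)
  define B :: real where "B = 4 ^ length k'"
  have B: "B \<ge> 0" "\<bar>T_partial k' n\<bar> \<le> B * sqrt (real n + 1)" for n
    using T_partial_bound[OF k'] by (auto simp: B_def)
  have bound: "\<bar>T_term k n\<bar> \<le> 2 * B * sqrt (real n) / real n ^ c" if "n \<ge> 1" for n
    unfolding k by (rule T_term_snoc_bound[OF cs that B(2)])
  show ?thesis
  proof (cases "c = 1")
    case False
    show ?thesis
    proof (rule summable_comparison_test'[OF summable_three_halves[of "2 * B"], of 1])
      fix n :: nat assume n: "n \<ge> 1"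
      have "2 * B * sqrt (real n) / real n ^ c \<le> 2 * B * sqrt (real n) / real n ^ 2"
        using False cs n B by (intro divide_left_mono power_increasing) auto
      then show "norm (T_term k n) \<le> 2 * B * (sqrt (real n) / real n ^ 2)"
        using bound[OF n] by simp
    qed
  next
    case True
    then have s: "s = - 1" using assms(3) cs by (auto simp: k)
    have inner: "\<bar>T_term k' n\<bar> \<le> 2 * B * sqrt (real n) / real n" if n: "n \<ge> 1" for n
    proof (cases "k' = []")
      case True
      then show ?thesis using n B by (simp add: T_term_def)
    next
      case False
      then obtain k'' d t where k'': "k' = k'' @ [(d, t)]"
        by (metis append_butlast_last_id surj_pair)
      have dt: "d \<ge> 1" "t = 1 \<or> t = - 1" and "is_index k''"
        using k' by (auto simp: k'' is_index_def)
      then have "\<bar>T_term k' n\<bar> \<le> 2 * 4 ^ length k'' * sqrt (real n) / real n ^ d"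
        unfolding k'' by (intro T_term_snoc_bound dt n T_partial_bound)
      also have "\<dots> \<le> 2 * B * sqrt (real n) / real n"
        using n dt self_le_power[of "real n" d]
        by (intro frac_le mult_right_mono) (auto simp: B_def k'')
      finally show ?thesis .
    qed
    have pair: "\<bar>T_term k n + T_term k (Suc n)\<bar> \<le> 8 * B * (sqrt (real n) / real n ^ 2)"
      if n: "n \<ge> length k" for n
    proof -
      have n1: "n \<ge> 1" using n by (simp add: k)
      define d where "d = 2 * real n - real (length k' + 1)"
      have d: "d \<ge> real n" "d > 0" using n n1 by (simp_all add: d_def k)
      let ?A = "T_partial k' (n - 1)" and ?A' = "T_partial k' n"
      have d': "2 * real (Suc n) - real (length k' + 1) = d + 2" by (simp add: d_def)
      have "T_term k n + T_term k (Suc n) = 2 * (- 1) ^ n * (?A / d - ?A' / (d + 2))"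
        using n1 unfolding k T_term_snoc d' True s d_def[symmetric] by (simp add: algebra_simps)
      also have "?A / d - ?A' / (d + 2) = (2 * ?A / d - (?A' - ?A)) / (d + 2)"
        using d by (simp add: field_simps)
      also have "?A' - ?A = T_term k' n"
        using n1 by (simp add: T_term_def)
      finally have "\<bar>T_term k n + T_term k (Suc n)\<bar> = 2 * (\<bar>2 * ?A / d - T_term k' n\<bar> / (d + 2))"
        using d by (simp add: abs_mult power_abs)
      also have "\<bar>2 * ?A / d - T_term k' n\<bar> \<le> 2 * B * sqrt (real n) / real n + 2 * B * sqrt (real n) / real n"
      proof -
        have "\<bar>?A\<bar> \<le> B * sqrt (real n)"
          using B(2)[of "n - 1"] n1 by (simp add: of_nat_diff)
        then have "2 * \<bar>?A\<bar> / d \<le> 2 * (B * sqrt (real n)) / real n"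
          using d n1 by (intro frac_le) (auto simp: B)
        then have "\<bar>2 * ?A / d\<bar> \<le> 2 * B * sqrt (real n) / real n"
          using d by (simp add: abs_mult)
        then show ?thesis using inner[OF n1] by linarith
      qed
      then have "2 * (\<bar>2 * ?A / d - T_term k' n\<bar> / (d + 2))
          \<le> 2 * ((2 * B * sqrt (real n) / real n + 2 * B * sqrt (real n) / real n) / real n)"
        using d n1 by (intro mult_left_mono frac_le) auto
      also have "\<dots> = 8 * B * (sqrt (real n) / real n ^ 2)"
        using n1 by (simp add: field_simps power2_eq_square)
      finally show ?thesis .
    qed
    have "T_term k \<longlonglongrightarrow> 0"
    proof (rule Lim_null_comparison)
      have "2 * B * sqrt (real n) / real n = 2 * B * (1 / sqrt (real n))" for n
        by (cases "n = 0") (simp_all add: real_div_sqrt field_simps)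
      then show "\<forall>\<^sub>F n in sequentially. norm (T_term k n) \<le> 2 * B * (1 / sqrt (real n))"
        using bound True by (intro eventually_sequentiallyI[of 1]) (auto simp del: times_divide_eq_right)
      have "(\<lambda>n. 1 / sqrt (real n)) \<longlonglongrightarrow> 0"
        by (intro tendsto_divide_0[OF tendsto_const] filterlim_at_top_imp_at_infinity
            filterlim_compose[OF sqrt_at_top] filterlim_real_sequentially)
      then show "(\<lambda>n. 2 * B * (1 / sqrt (real n))) \<longlonglongrightarrow> 0"
        by (rule tendsto_mult_right_zero)
    qed
    moreover have "summable (\<lambda>n. T_term k n + T_term k (Suc n))"
      by (rule summable_comparison_test'[OF summable_three_halves[of "8 * B"], of "length k"])
        (use pair in simp)
    ultimately show ?thesis by (rule summable_of_pairs)
  qed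
qed

lemma T_term_sums:
  assumes "k \<noteq> []" "is_index k" "last k \<noteq> (1, 1)"
  shows "T_term k sums T_value k"
proof -
  obtain S where S: "T_term k sums S"
    using summable_T_term[OF assms] by (auto simp: summable_def)
  then have "T_partial k \<longlonglongrightarrow> S"
    by (simp add: sums_def_le sum_T_term)
  then show ?thesis using S by (simp add: T_value_def limI)
qed

text \<open>
  The series of the word, times \<open>x ^ r\<close>, is a power series in \<open>x\<^sup>2\<close> with the terms of the index as coefficients,
  so that Abel's limit theorem applies at \<open>x\<^sup>2\<close>.
\<close>

lemma iter_rword_limit:
  assumes "k \<noteq> []" "is_index k" "last k \<noteq> (1, 1)"
  shows "(eval_fps (iter (rword (rev k) 1)) \<longlongrightarrow> word_sign (rword (rev k) 1) * T_value k) (at_left 1)"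
proof -
  let ?u = "rword (rev k) 1" and ?r = "length k"
  \<comment> \<open>Multiplication by \<open>x ^ r\<close> moves the exponents \<open>2 * n - r\<close> to the even numbers \<open>2 * n\<close>; the coefficients
      below \<open>r\<close> vanish because an increasing chain of length \<open>r\<close> cannot end before \<open>r\<close>.\<close>
  have eq: "eval_fps (iter ?u) x = word_sign ?u * (\<Sum>n. T_term k n * (x\<^sup>2) ^ n) / x ^ ?r"
    if x: "0 < x" "x < 1" for x
  proof -
    define f where "f M = (if even M then word_sign ?u * T_term k (M div 2) * x ^ M else 0)" for M
    have "(\<lambda>m. fps_nth (iter ?u) m * x ^ m) sums eval_fps (iter ?u) x"
      using less_iter_conv_radius[of x ?u] x by (intro sums_eval_fps) simp
    then have "(\<lambda>m. x ^ ?r * (fps_nth (iter ?u) m * x ^ m)) sums (x ^ ?r * eval_fps (iter ?u) x)"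
      by (rule sums_mult)
    moreover have "x ^ ?r * (fps_nth (iter ?u) m * x ^ m) = f (m + ?r)" for m
      using iter_rword_nth[OF assms(2), of 1 m] by (simp add: f_def power_add)
    moreover have "(\<Sum>M<?r. f M) = 0"
      by (intro sum.neutral) (auto simp: f_def T_term_less_length)
    ultimately have "f sums (x ^ ?r * eval_fps (iter ?u) x)"
      using sums_iff_shift[of f ?r "x ^ ?r * eval_fps (iter ?u) x"] by simp
    moreover have "strict_mono (\<lambda>n::nat. 2 * n)"
      by (simp add: strict_mono_def)
    ultimately have "(\<lambda>n. f (2 * n)) sums (x ^ ?r * eval_fps (iter ?u) x)"
      by (subst sums_mono_reindex) (auto simp: f_def)
    moreover have "f (2 * n) = word_sign ?u * (T_term k n * (x\<^sup>2) ^ n)" for n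
      by (simp add: f_def power_mult)
    ultimately have s: "(\<lambda>n. word_sign ?u * (T_term k n * (x\<^sup>2) ^ n)) sums (x ^ ?r * eval_fps (iter ?u) x)"
      by simp
    have "summable (\<lambda>n. T_term k n * (x\<^sup>2) ^ n)"
      using powser_inside[of "T_term k" 1 "x\<^sup>2"] summable_T_term[OF assms] x
      by (simp add: abs_square_less_1 power_less_one_iff)
    then have "x ^ ?r * eval_fps (iter ?u) x = word_sign ?u * (\<Sum>n. T_term k n * (x\<^sup>2) ^ n)"
      using s by (simp add: sums_iff suminf_mult)
    then show ?thesis using x by (simp add: field_simps)
  qed
  have unit: "\<forall>\<^sub>F x in at_left (1::real). x \<in> {0<..<1}"
    by (rule eventually_at_left_real) simp
  have square: "filterlim (\<lambda>x::real. x\<^sup>2) (at_left 1) (at_left 1)"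
    unfolding filterlim_at
  proof
    show "((\<lambda>x::real. x\<^sup>2) \<longlongrightarrow> 1) (at_left 1)"
      by (auto intro!: tendsto_eq_intros)
    show "\<forall>\<^sub>F x in at_left (1::real). x\<^sup>2 \<in> {..<1} \<and> x\<^sup>2 \<noteq> 1"
      using unit
    proof eventually_elim
      case (elim x)
      then have "x\<^sup>2 < 1" by (simp add: abs_square_less_1)
      then show ?case by simp
    qed
  qed
  have "((\<lambda>x. \<Sum>n. T_term k n * (x\<^sup>2) ^ n) \<longlongrightarrow> T_value k) (at_left 1)"
    using filterlim_compose[OF Abel_limit[OF T_term_sums[OF assms]] square] .
  then have "((\<lambda>x. word_sign ?u * (\<Sum>n. T_term k n * (x\<^sup>2) ^ n) / x ^ ?r)
      \<longlongrightarrow> word_sign ?u * T_value k / 1 ^ ?r) (at_left 1)"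
    by (intro tendsto_divide tendsto_mult tendsto_const tendsto_power tendsto_ident_at) auto
  then have "((\<lambda>x. word_sign ?u * (\<Sum>n. T_term k n * (x\<^sup>2) ^ n) / x ^ ?r)
      \<longlongrightarrow> word_sign ?u * T_value k) (at_left 1)"
    by simp
  moreover have "\<forall>\<^sub>F x in at_left 1. word_sign ?u * (\<Sum>n. T_term k n * (x\<^sup>2) ^ n) / x ^ ?r
      = eval_fps (iter ?u) x"
    using unit by eventually_elim (simp add: eq)
  ultimately show ?thesis
    by (rule Lim_transform_eventually)
qed

section \<open>The word of the dual index\<close>

lemma dual_letter_omega: "t = 1 \<or> t = - 1 \<Longrightarrow> dual_letter (omega t) = u_letter t"
  by (auto simp: omega_def u_letter_def)

lemma dual_letter_eq_iff [simp]:
  "dual_letter a = Omega_m1 \<longleftrightarrow> a = Omega_m1"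
  "dual_letter a = Omega_0 \<longleftrightarrow> a = Omega_1"
  "dual_letter a = Omega_1 \<longleftrightarrow> a = Omega_0"
  by (cases a; simp)+

lemma word_sign_map_dual_letter: "word_sign (map dual_letter u) = word_sign u"
  by (induction u) auto

lemma word_sign_rev: "word_sign (rev u) = word_sign u"
  by (induction u) auto

lemma word_sign_nonzero: "word_sign u \<noteq> 0"
  by (induction u) auto

text \<open>
  Reading the letters from the outermost one and exchanging \<open>Omega_0\<close> with \<open>Omega_1\<close> is exactly how the dual word is
  written down. The twist \<open>s\<close> is needed for the same reason as in \<open>rword\<close>; the case \<open>s = 1\<close> is the one of interest.
\<close>

lemma dual_word_twisted:
  assumes "is_index k" "s = 1 \<or> s = - 1"
  shows "concat (map (\<lambda>j. replicate (fst (k ! j) - 1) Omega_1 @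
                        [u_letter (s * (\<Prod>i=j..<length k. snd (k ! i)))])
       (rev [0..<length k])) = map dual_letter (rword (rev k) s)"
  using assms
proof (induction k arbitrary: s rule: rev_induct)
  case Nil
  then show ?case by simp
next
  case (snoc x k)
  have x: "snd x = 1 \<or> snd x = - 1" and k: "is_index k"
    using snoc.prems(1) by (auto simp: is_index_def)
  have "concat (map (\<lambda>j. replicate (fst ((k @ [x]) ! j) - 1) Omega_1 @
            [u_letter (s * (\<Prod>i=j..<length (k @ [x]). snd ((k @ [x]) ! i)))]) (rev [0..<length k]))
      = concat (map (\<lambda>j. replicate (fst (k ! j) - 1) Omega_1 @
            [u_letter ((s * snd x) * (\<Prod>i=j..<length k. snd (k ! i)))]) (rev [0..<length k]))"
  proof (intro arg_cong[of _ _ concat] map_cong refl)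
    fix j assume "j \<in> set (rev [0..<length k])"
    then have j: "j < length k" by simp
    then have "(\<Prod>i=j..<length (k @ [x]). snd ((k @ [x]) ! i)) = (\<Prod>i=j..<length k. snd (k ! i)) * snd x"
      by (simp add: prod.atLeastLessThan_Suc nth_append)
    then show "replicate (fst ((k @ [x]) ! j) - 1) Omega_1 @
            [u_letter (s * (\<Prod>i=j..<length (k @ [x]). snd ((k @ [x]) ! i)))]
        = replicate (fst (k ! j) - 1) Omega_1 @
            [u_letter ((s * snd x) * (\<Prod>i=j..<length k. snd (k ! i)))]"
      using j by (simp add: nth_append mult_ac)
  qed
  also have "\<dots> = map dual_letter (rword (rev k) (s * snd x))"
    using x snoc.prems(2) by (intro snoc.IH k) auto
  finally show ?case
    using x snoc.prems(2) dual_letter_omega[of "s * snd x"] by (auto simp: map_replicate_const)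
qed

lemma dual_word_eq: "is_index k \<Longrightarrow> dual_word k = map dual_letter (rword (rev k) 1)"
  using dual_word_twisted[of k 1] by (simp add: dual_word_def)

lemma rword_append: "rword (xs @ ys) s = rword xs s @ rword ys (s * prod_list (map snd xs))"
  by (induction xs arbitrary: s) (auto simp: mult_ac)

text \<open>
  The suffix products of sign quotients telescope, so \<open>rword\<close> recovers the letter signs from them. The
  claim about the product of all quotients supplies the accumulated sign in the inductive step.
\<close>

lemma rword_sign_quotients:
  assumes "is_index bs"
  shows "rword (rev (sign_quotients bs)) 1 = rev (word_of_blocks bs)
    \<and> (bs \<noteq> [] \<longrightarrow> prod_list (map snd (sign_quotients bs)) = snd (hd bs))"
  using assms
proof (induction bs rule: sign_quotients.induct)
  case (3 c t c' t' bs)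
  let ?q = "sign_quotients ((c', t') # bs)"
  have t: "t = 1 \<or> t = - 1" "t' = 1 \<or> t' = - 1"
    using "3.prems" by auto
  have IH: "rword (rev ?q) 1 = rev (word_of_blocks ((c', t') # bs))"
    "prod_list (map snd ?q) = t'"
    using "3.IH" "3.prems" by auto
  have tt: "t' * (t div t') = t" using t by auto
  have "prod_list (map snd (rev ?q)) = t'"
    using IH(2) by (simp only: rev_map[symmetric] prod_list.rev)
  then have "rword (rev ?q @ [(c, t div t')]) 1 =
     rev (word_of_blocks ((c', t') # bs)) @ replicate (c - 1) Omega_0 @ [omega t]"
    unfolding rword_append IH(1) using tt by simp
  moreover have "prod_list (map snd ((c, t div t') # ?q)) = t"
    using IH(2) tt by (simp add: mult.commute)
  ultimately show ?case by simp
qed auto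

lemma sign_quotients_Nil_iff [simp]: "sign_quotients bs = [] \<longleftrightarrow> bs = []"
  by (induction bs rule: sign_quotients.induct) auto

lemma last_sign_quotients: "last (sign_quotients bs) = last bs"
  by (induction bs rule: sign_quotients.induct) auto

lemma is_index_sign_quotients: "is_index bs \<Longrightarrow> is_index (sign_quotients bs)"
  by (induction bs rule: sign_quotients.induct) auto

text \<open>
  This is where the condition on the last entry enters: it keeps the outermost form integrable at \<open>1\<close>, and makes the dual
  word start with a letter other than \<open>Omega_0\<close>.
\<close>

lemma hd_rword:
  assumes "k \<noteq> []" "is_index k" "last k \<noteq> (1, 1)"
  shows "rword (rev k) 1 \<noteq> [] \<and> hd (rword (rev k) 1) \<noteq> Omega_1"
proof -
  obtain k' c s where k: "k = k' @ [(c, s)]"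
    using assms(1) by (metis append_butlast_last_id surj_pair)
  then show ?thesis
    using assms(2,3) by (cases "c - 1") (auto simp: is_index_def omega_def)
qed

lemma regular_rword:
  assumes "is_index k" "s = 1 \<or> s = - 1"
  shows "regular (rword (rev k) s)"
  using assms
proof (induction k arbitrary: s rule: rev_induct)
  case Nil
  then show ?case by (simp add: regular_def)
next
  case (snoc x k)
  have x: "snd x = 1 \<or> snd x = - 1" and k: "is_index k"
    using snoc.prems(1) by (auto simp: is_index_def)
  have "regular (rword (rev k) (s * snd x))"
    using x snoc.prems(2) by (intro snoc.IH k) auto
  then show ?case
    using x snoc.prems(2) by (auto simp: regular_def omega_def)
qed

lemma dual_index_word:
  assumes "k \<noteq> []" "is_index k" "last k \<noteq> (1, 1)"
  shows "rword (rev (dual_index k)) 1 = map dual_letter (rev (rword (rev k) 1))"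
    and "dual_index k \<noteq> []" "is_index (dual_index k)" "last (dual_index k) \<noteq> (1, 1)"
proof -
  let ?u = "rword (rev k) 1" and ?bs = "blocks (dual_word k)"
  have w: "dual_word k = map dual_letter ?u"
    by (rule dual_word_eq[OF assms(2)])
  have u: "?u \<noteq> []" "hd ?u \<noteq> Omega_1" "last ?u \<noteq> Omega_0"
    using hd_rword[OF assms] regular_rword[OF assms(2), of 1] by (auto simp: regular_def)
  have "hd (dual_word k) \<noteq> Omega_0"
    unfolding w using u by (simp add: hd_map)
  then have "is_index ?bs \<and> word_of_blocks ?bs = dual_word k"
    unfolding blocks_def by (intro theI'[OF ex1_blocks] disjI2)
  then have bs: "is_index ?bs" "word_of_blocks ?bs = dual_word k" by auto
  then have ne: "?bs \<noteq> []" using u w by auto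
  show "rword (rev (dual_index k)) 1 = map dual_letter (rev ?u)"
    using rword_sign_quotients[OF bs(1)] bs(2) w by (simp add: dual_index_def q_index_def rev_map)
  show "dual_index k \<noteq> []" "is_index (dual_index k)"
    using ne bs(1) by (simp_all add: dual_index_def q_index_def is_index_sign_quotients)
  \<comment> \<open>A last entry \<open>(1, 1)\<close> would make the dual word end in \<open>Omega_1\<close>, the dual of the letter \<open>Omega_0\<close>, with
      which the word of an index cannot start.\<close>
  show "last (dual_index k) \<noteq> (1, 1)"
  proof
    assume "last (dual_index k) = (1, 1)"
    then have "?bs = butlast ?bs @ [(1, 1)]"
      using ne by (metis append_butlast_last_id dual_index_def last_sign_quotients q_index_def)
    moreover have "word_of_blocks (butlast ?bs @ [(1, 1)]) = word_of_blocks (butlast ?bs) @ [Omega_1]"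
      by (simp add: word_of_blocks_def omega_def)
    ultimately have "dual_word k = word_of_blocks (butlast ?bs) @ [Omega_1]"
      using bs(2) by simp
    then have "last (dual_word k) = Omega_1" by (metis last_snoc)
    then show False using u unfolding w by (simp add: last_map)
  qed
qed

theorem theorem2p2p1:
  fixes k :: index
  assumes "k \<noteq> []"
    and "is_index k"
    and "last k \<noteq> (1, 1)"
  shows "T_value k = T_value (dual_index k)"
proof -
  let ?u = "rword (rev k) 1"
  note dual = dual_index_word[OF assms]
  have u: "regular ?u" "regular (map dual_letter (rev ?u))"
    using regular_rword[OF assms(2), of 1] hd_rword[OF assms]
    by (auto simp: regular_def last_map last_rev)
  have "(eval_fps (iter (map dual_letter (rev ?u))) \<longlongrightarrow> word_sign ?u * T_value k) (at_left 1)"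
    by (rule iterated_integral_duality[OF u iter_rword_limit[OF assms]])
  moreover have "(eval_fps (iter (map dual_letter (rev ?u))) \<longlongrightarrow> word_sign ?u * T_value (dual_index k)) (at_left 1)"
    using iter_rword_limit[OF dual(2-4)] unfolding dual(1) word_sign_map_dual_letter word_sign_rev .
  ultimately have "word_sign ?u * T_value k = word_sign ?u * T_value (dual_index k)"
    using tendsto_unique trivial_limit_at_left_real by blast
  then show ?thesis using word_sign_nonzero by simp
qed

end
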